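(* Let $n\ge1$, let $x_0,\ldots,x_n$ be distinct complex points with function values $f_0,\ldots,f_n\in\mathbb{C}$, and suppose that the inverse differences $\varphi_i:=\varphi_i[x_0,\ldots,x_i]$ are finite ($\varphi_i\neq\infty$) for $i=0,\ldots,n$. Let $$C_n(x)=\varphi_0+\cfrac{x-x_0}{\varphi_1+\cfrac{x-x_1}{\varphi_2+\ddots+\cfrac{x-x_{n-1}}{\varphi_n}}}$$ be the associated Thiele continued fraction. In case $n$ is odd, assume in addition that $$\sum_{\substack{0\le i\le n\\ i\ \mathrm{odd}}}\varphi_i\neq 0 .$$ Let the $n\times n$ matrices $\mathbf{D}$ and $\mathbf{C}$ be $$\mathbf{D}=\begin{pmatrix}\varphi_1&-x_1&0&\cdots&0\\-1&\varphi_2&-x_2&\ddots&\vdots\\0&-1&\varphi_3&\ddots&0\\\vdots&\ddots&\ddots&\ddots&-x_{n-1}\\0&\cdots&0&-1&\varphi_n\end{pmatrix},\qquad \mathbf{C}=\begin{pmatrix}0&-1&0&\cdots&0\\0&0&-1&\ddots&\vdots\\0&0&0&\ddots&0\\\vdots&\ddots&\ddots&\ddots&-1\\0&\cdots&0&0&0\end{pmatrix}.$$ Then the matrix pencil $\mathbf{D}-\lambda\mathbf{C}$ is regular and its finite eigenvalues coincide with the $\lfloor n/2\rfloor$ poles of $C_n(x)$, counting multiplicities.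
   Context: Inverse differences take values in $\mathbb{C}\cup\{\infty\}$ and are defined by $$\varphi_0[x_k]=f_k\quad(0\le k\le n),\qquad \varphi_{i+1}[x_0,\ldots,x_i,x_k]=\frac{x_k-x_i}{\varphi_i[x_0,\ldots,x_{i-1},x_k]-\varphi_i[x_0,\ldots,x_i]}\quad(0\le i<k\le n),$$ with the conventions $c/0=\infty$ for $c\in\mathbb{C}\setminus\{0\}$, $\infty-c=\infty$ and $c/\infty=0$ for $c\in\mathbb{C}$. One writes $C_n(x)=A_n(x)/B_n(x)$, where the numerators $A_m$ and denominators $B_m$ are given by $A_{-1}=1$, $B_{-1}=0$, $A_0=\varphi_0$, $B_0=1$ and, for $m\ge1$, $$A_m(x)=\varphi_mA_{m-1}(x)+(x-x_{m-1})A_{m-2}(x),\qquad B_m(x)=\varphi_mB_{m-1}(x)+(x-x_{m-1})B_{m-2}(x).$$ The poles of $C_n(x)$, counting multiplicities, are understood as the zeros, counting multiplicities, of the denominator polynomial $B_n(x)$ (with no cancellation of possible common factors with $A_n$). A matrix pencil $\mathbf{D}-\lambda\mathbf{C}$ is regular if $\det(\mathbf{D}-\lambda\mathbf{C})\not\equiv0$ as a polynomial in $\lambda$; its finite eigenvalues, with multiplicities, are the zeros of that polynomial. *)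

theory Defs
  imports
    "HOL-Computational_Algebra.Polynomial"
    "Jordan_Normal_Form.Determinant"
begin

datatype complex_ext = Finite complex | Infinite

text \<open>The cases \<open>c - \<infinity>\<close>, \<open>\<infinity> - \<infinity>\<close> and \<open>0 / 0\<close> are completed arbitrarily by \<open>\<infinity>\<close>:
  they do not arise in inverse differences with distinct points and finite \<open>\<phi>\<^sub>i\<close>.\<close>

fun minus_ext :: "complex_ext \<Rightarrow> complex_ext \<Rightarrow> complex_ext" where
  "minus_ext (Finite a) (Finite c) = Finite (a - c)"
| "minus_ext Infinite (Finite c) = Infinite"
| "minus_ext _ Infinite = Infinite"

fun divide_ext :: "complex \<Rightarrow> complex_ext \<Rightarrow> complex_ext" where
  "divide_ext c (Finite a) = (if a = 0 then Infinite else Finite (c / a))"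
| "divide_ext c Infinite = Finite 0"

text \<open>\<open>inverse_difference x f i k\<close> is \<open>\<phi>\<^sub>i[x\<^sub>0, \<dots>, x\<^bsub>i-1\<^esub>, x\<^sub>k]\<close>; it is meaningful for \<open>i \<le> k\<close>.\<close>

fun inverse_difference :: "(nat \<Rightarrow> complex) \<Rightarrow> (nat \<Rightarrow> complex) \<Rightarrow> nat \<Rightarrow> nat \<Rightarrow> complex_ext" where
  "inverse_difference x f 0 k = Finite (f k)"
| "inverse_difference x f (Suc i) k =
     divide_ext (x k - x i)
       (minus_ext (inverse_difference x f i k) (inverse_difference x f i i))"

text \<open>\<open>thiele_tail \<phi> x z i d\<close> is the nested fraction
  \<open>\<phi>\<^sub>i + (z - x\<^sub>i) / (\<phi>\<^bsub>i+1\<^esub> + \<dots> + (z - x\<^bsub>i+d-1\<^esub>) / \<phi>\<^bsub>i+d\<^esub>)\<close>.\<close>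

fun thiele_tail ::
    "(nat \<Rightarrow> complex) \<Rightarrow> (nat \<Rightarrow> complex) \<Rightarrow> complex \<Rightarrow> nat \<Rightarrow> nat \<Rightarrow> complex" where
  "thiele_tail \<phi> x z i 0 = \<phi> i"
| "thiele_tail \<phi> x z i (Suc d) = \<phi> i + (z - x i) / thiele_tail \<phi> x z (Suc i) d"

definition thiele_fraction ::
    "(nat \<Rightarrow> complex) \<Rightarrow> (nat \<Rightarrow> complex) \<Rightarrow> nat \<Rightarrow> complex \<Rightarrow> complex" where
  "thiele_fraction \<phi> x n z = thiele_tail \<phi> x z 0 n"

text \<open>The second equations of the two recursions below are the case \<open>m = 1\<close> of the three-term
  recurrence with the initial values \<open>A\<^bsub>-1\<^esub> = 1\<close> and \<open>B\<^bsub>-1\<^esub> = 0\<close>.\<close>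

fun thiele_num :: "(nat \<Rightarrow> complex) \<Rightarrow> (nat \<Rightarrow> complex) \<Rightarrow> nat \<Rightarrow> complex poly" where
  "thiele_num \<phi> x 0 = [:\<phi> 0:]"
| "thiele_num \<phi> x (Suc 0) = smult (\<phi> 1) (thiele_num \<phi> x 0) + [:- x 0, 1:] * 1"
| "thiele_num \<phi> x (Suc (Suc m)) =
     smult (\<phi> (Suc (Suc m))) (thiele_num \<phi> x (Suc m)) + [:- x (Suc m), 1:] * thiele_num \<phi> x m"

fun thiele_den :: "(nat \<Rightarrow> complex) \<Rightarrow> (nat \<Rightarrow> complex) \<Rightarrow> nat \<Rightarrow> complex poly" where
  "thiele_den \<phi> x 0 = 1"
| "thiele_den \<phi> x (Suc 0) = smult (\<phi> 1) (thiele_den \<phi> x 0) + [:- x 0, 1:] * 0"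
| "thiele_den \<phi> x (Suc (Suc m)) =
     smult (\<phi> (Suc (Suc m))) (thiele_den \<phi> x (Suc m)) + [:- x (Suc m), 1:] * thiele_den \<phi> x m"

text \<open>The nested fraction has the value \<open>A\<^sub>n / B\<^sub>n\<close> wherever it can be evaluated without
  dividing by zero.\<close>

lemma thiele_fraction_eq:
  assumes nz: "\<And>i. 1 \<le> i \<Longrightarrow> i \<le> n \<Longrightarrow> thiele_tail \<phi> x z i (n - i) \<noteq> 0"
  shows "poly (thiele_den \<phi> x n) z \<noteq> 0"
    and "thiele_fraction \<phi> x n z = poly (thiele_num \<phi> x n) z / poly (thiele_den \<phi> x n) z"
proof -
  define t where "t = (\<lambda>i. thiele_tail \<phi> x z i (n - i))"
  have tn: "t n = \<phi> n" by (simp add: t_def)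
  have t0: "t i \<noteq> 0" if "1 \<le> i" "i \<le> n" for i using nz that by (simp add: t_def)
  have step: "t i * t (Suc i) = \<phi> i * t (Suc i) + (z - x i)" if "i < n" for i
  proof -
    have "n - i = Suc (n - Suc i)" using that by simp
    then have "t i = \<phi> i + (z - x i) / t (Suc i)" by (simp add: t_def)
    then show ?thesis using t0[of "Suc i"] that by (simp add: field_simps)
  qed
  have key: "t (Suc m) * poly (thiele_num \<phi> x m) z
        + (z - x m) * (if m = 0 then 1 else poly (thiele_num \<phi> x (m - 1)) z) = (\<Prod>i\<le>Suc m. t i)
      \<and> t (Suc m) * poly (thiele_den \<phi> x m) z
        + (z - x m) * (if m = 0 then 0 else poly (thiele_den \<phi> x (m - 1)) z) = (\<Prod>i=1..Suc m. t i)"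
    if "Suc m \<le> n" for m
    using that
  proof (induction m)
    case 0
    then show ?case using step[of 0] by (simp add: algebra_simps)
  next
    case (Suc m)
    have s: "t (Suc (Suc m)) * (\<phi> (Suc m) * a + b) + (z - x (Suc m)) * a
        = (t (Suc m) * a + b) * t (Suc (Suc m))" for a b
      using arg_cong[OF step[of "Suc m"], of "\<lambda>u. u * a"] Suc.prems by (simp add: algebra_simps)
    have n: "poly (thiele_num \<phi> x (Suc m)) z = \<phi> (Suc m) * poly (thiele_num \<phi> x m) z
        + (z - x m) * (if m = 0 then 1 else poly (thiele_num \<phi> x (m - 1)) z)"
      by (cases m) (simp_all add: algebra_simps)
    have d: "poly (thiele_den \<phi> x (Suc m)) z = \<phi> (Suc m) * poly (thiele_den \<phi> x m) z
        + (z - x m) * (if m = 0 then 0 else poly (thiele_den \<phi> x (m - 1)) z)"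
      by (cases m) (simp_all add: algebra_simps)
    have IH: "t (Suc m) * poly (thiele_num \<phi> x m) z
        + (z - x m) * (if m = 0 then 1 else poly (thiele_num \<phi> x (m - 1)) z) = (\<Prod>i\<le>Suc m. t i)"
      "t (Suc m) * poly (thiele_den \<phi> x m) z
        + (z - x m) * (if m = 0 then 0 else poly (thiele_den \<phi> x (m - 1)) z) = (\<Prod>i=1..Suc m. t i)"
      using Suc by auto
    have "(\<Prod>i\<le>Suc (Suc m). t i) = (\<Prod>i\<le>Suc m. t i) * t (Suc (Suc m))"
      "(\<Prod>i=1..Suc (Suc m). t i) = (\<Prod>i=1..Suc m. t i) * t (Suc (Suc m))"
      by (simp_all add: mult.commute)
    then show ?case unfolding n d s IH by (simp add: n d s IH del: thiele_num.simps thiele_den.simps prod.atMost_Suc prod.cl_ivl_Suc)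
  qed
  have num: "poly (thiele_num \<phi> x n) z = (\<Prod>i\<le>n. t i)"
    and den: "poly (thiele_den \<phi> x n) z = (\<Prod>i=1..n. t i)"
  proof -
    have "poly (thiele_num \<phi> x n) z = (\<Prod>i\<le>n. t i) \<and> poly (thiele_den \<phi> x n) z = (\<Prod>i=1..n. t i)"
    proof (cases n)
      case 0
      then show ?thesis using tn by simp
    next
      case (Suc m)
      then show ?thesis using key[of m] tn by (cases m) (simp_all add: algebra_simps)
    qed
    then show "poly (thiele_num \<phi> x n) z = (\<Prod>i\<le>n. t i)"
      "poly (thiele_den \<phi> x n) z = (\<Prod>i=1..n. t i)" by auto
  qed
  show den0: "poly (thiele_den \<phi> x n) z \<noteq> 0" unfolding den using t0 by auto
  have "(\<Prod>i\<le>n. t i) = t 0 * (\<Prod>i=1..n. t i)"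
    by (simp add: prod.atMost_shift prod.atLeast1_atMost_eq)
  then have "t 0 = poly (thiele_num \<phi> x n) z / poly (thiele_den \<phi> x n) z"
    using den0 num den by (simp add: field_simps)
  then show "thiele_fraction \<phi> x n z = poly (thiele_num \<phi> x n) z / poly (thiele_den \<phi> x n) z"
    by (simp add: thiele_fraction_def t_def)
qed

text \<open>Common zeros of \<open>A\<^sub>n\<close> and \<open>B\<^sub>n\<close> are not cancelled.\<close>

definition thiele_poles :: "(nat \<Rightarrow> complex) \<Rightarrow> (nat \<Rightarrow> complex) \<Rightarrow> nat \<Rightarrow> complex multiset" where
  "thiele_poles \<phi> x n = proots (thiele_den \<phi> x n)"

text \<open>Matrix indices are zero-based: the entry \<open>(i, i)\<close> of \<open>D\<close> is \<open>\<phi>\<^bsub>i+1\<^esub>\<close> for \<open>i < n\<close>.\<close>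

definition thiele_D :: "(nat \<Rightarrow> complex) \<Rightarrow> (nat \<Rightarrow> complex) \<Rightarrow> nat \<Rightarrow> complex mat" where
  "thiele_D \<phi> x n = mat n n (\<lambda>(i, j).
     if j = i then \<phi> (i + 1) else if j = i + 1 then - x j else if i = j + 1 then - 1 else 0)"

definition thiele_C :: "nat \<Rightarrow> complex mat" where
  "thiele_C n = mat n n (\<lambda>(i, j). if j = i + 1 then - 1 else 0)"

text \<open>The determinant of \<open>D - \<lambda>C\<close> as a polynomial in \<open>\<lambda>\<close>.\<close>

definition pencil_det :: "complex mat \<Rightarrow> complex mat \<Rightarrow> complex poly" where
  "pencil_det D C = det (map_mat (\<lambda>d. [:d:]) D - [:0, 1:] \<cdot>\<^sub>m map_mat (\<lambda>c. [:c:]) C)"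

definition regular_pencil :: "complex mat \<Rightarrow> complex mat \<Rightarrow> bool" where
  "regular_pencil D C \<longleftrightarrow> pencil_det D C \<noteq> 0"

definition finite_eigenvalues :: "complex mat \<Rightarrow> complex mat \<Rightarrow> complex multiset" where
  "finite_eigenvalues D C = proots (pencil_det D C)"

end

theory Submission
  imports
    Defs
    "HOL-Computational_Algebra.Fundamental_Theorem_Algebra"
begin

text \<open>Expanding the tridiagonal determinant \<open>det (D - \<lambda> C)\<close> along its last row yields the
  three-term recurrence of the denominators, so it equals \<open>B\<^sub>n\<close> as a polynomial. By the same
  recurrence, \<open>B\<^sub>n\<close> has degree at most \<open>\<lfloor>n/2\<rfloor>\<close>, and its coefficient in that degree is \<open>1\<close> for even
  \<open>n\<close> and the sum of the \<open>\<phi>\<^sub>i\<close> with odd \<open>i\<close> for odd \<open>n\<close>.\<close>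

definition tridiagonal_mat ::
    "(nat \<Rightarrow> 'a) \<Rightarrow> (nat \<Rightarrow> 'a) \<Rightarrow> (nat \<Rightarrow> 'a) \<Rightarrow> nat \<Rightarrow> 'a :: zero mat" where
  "tridiagonal_mat a b c n = mat n n (\<lambda>(i, j).
     if j = i then a i else if j = i + 1 then b i else if i = j + 1 then c j else 0)"

lemma tridiagonal_mat_carrier [simp]: "tridiagonal_mat a b c n \<in> carrier_mat n n"
  by (simp add: tridiagonal_mat_def)

lemma det_tridiagonal_mat_0 [simp]: "det (tridiagonal_mat a b c 0) = (1 :: 'a :: comm_ring_1)"
  by (rule det_dim_zero) simp

lemma det_tridiagonal_mat_1 [simp]:
  "det (tridiagonal_mat a b c (Suc 0)) = (a 0 :: 'a :: comm_ring_1)"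
  by (simp add: det_single tridiagonal_mat_def)

text \<open>Laplace expansion along the last row, whose only nonzero entries are \<open>c m\<close>
  and \<open>a (Suc m)\<close>. Off-diagonal entries carry the smaller of their two indices, so
  \<open>b m\<close> and \<open>c m\<close> are the opposite pair.\<close>

lemma det_tridiagonal_mat_Suc_Suc:
  fixes a b c :: "nat \<Rightarrow> 'a :: comm_ring_1"
  shows "det (tridiagonal_mat a b c (Suc (Suc m))) =
    a (Suc m) * det (tridiagonal_mat a b c (Suc m)) - b m * c m * det (tridiagonal_mat a b c m)"
proof -
  define T where "T = tridiagonal_mat a b c (Suc (Suc m))"
  define M where "M = mat_delete T (Suc m) m"
  have T: "T \<in> carrier_mat (Suc (Suc m)) (Suc (Suc m))"
    by (simp add: T_def)
  have M: "M \<in> carrier_mat (Suc m) (Suc m)"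
    using mat_delete_carrier[OF T] by (simp add: M_def)
  \<comment> \<open>The last column of \<open>M\<close> is the last column of \<open>T\<close>
    without its bottom entry, so only \<open>b m\<close> survives in it.\<close>
  have "det M = (\<Sum>i<Suc m. M $$ (i, m) * cofactor M i m)"
    using M by (rule laplace_expansion_column) simp
  also have "\<dots> = M $$ (m, m) * cofactor M m m"
    by (simp add: M_def T_def mat_delete_def tridiagonal_mat_def)
  also have "M $$ (m, m) = b m"
    by (simp add: M_def T_def mat_delete_def tridiagonal_mat_def)
  also have "mat_delete M m m = tridiagonal_mat a b c m"
    by (rule eq_matI) (auto simp: M_def T_def mat_delete_def tridiagonal_mat_def)
  then have "cofactor M m m = det (tridiagonal_mat a b c m)"
    by (simp add: cofactor_def)
  finally have det_M: "det M = b m * det (tridiagonal_mat a b c m)" .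
  have "mat_delete T (Suc m) (Suc m) = tridiagonal_mat a b c (Suc m)"
    by (rule eq_matI) (auto simp: T_def mat_delete_def tridiagonal_mat_def)
  then have cof: "cofactor T (Suc m) (Suc m) = det (tridiagonal_mat a b c (Suc m))"
    "cofactor T (Suc m) m = - det M"
    by (simp_all add: cofactor_def M_def)
  have "det T = (\<Sum>j<Suc (Suc m). T $$ (Suc m, j) * cofactor T (Suc m) j)"
    using T by (rule laplace_expansion_row) simp
  also have "\<dots> = c m * cofactor T (Suc m) m + a (Suc m) * cofactor T (Suc m) (Suc m)"
    by (simp add: T_def tridiagonal_mat_def)
  finally show ?thesis
    unfolding cof det_M by (simp add: T_def algebra_simps)
qed

text \<open>The subdiagonal -1 turns \<open>- b m * c m\<close> into plus the linear factor. The
  point \<open>x 0\<close> is absent because its factor meets only the zero initial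
  denominator.\<close>

lemma thiele_den_eq_det_tridiagonal_mat:
  "thiele_den \<phi> x n =
    det (tridiagonal_mat (\<lambda>i. [:\<phi> (Suc i):]) (\<lambda>i. [:- x (Suc i), 1:]) (\<lambda>_. - 1) n)"
  by (induction \<phi> x n rule: thiele_den.induct)
    (simp_all add: det_tridiagonal_mat_Suc_Suc)

lemma pencil_det_thiele: "pencil_det (thiele_D \<phi> x n) (thiele_C n) = thiele_den \<phi> x n"
proof -
  have "map_mat (\<lambda>d. [:d:]) (thiele_D \<phi> x n) - [:0, 1:] \<cdot>\<^sub>m map_mat (\<lambda>c. [:c:]) (thiele_C n) =
      tridiagonal_mat (\<lambda>i. [:\<phi> (Suc i):]) (\<lambda>i. [:- x (Suc i), 1:]) (\<lambda>_. - 1) n"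
    \<comment> \<open>\<open>one_pCons\<close> identifies the ring element -1 with a constant
      polynomial.\<close>
    by (rule eq_matI) (auto simp: thiele_D_def thiele_C_def tridiagonal_mat_def one_pCons)
  then show ?thesis
    by (simp add: pencil_det_def thiele_den_eq_det_tridiagonal_mat)
qed

lemma coeff_linear_mult_Suc:
  fixes p :: "'a :: comm_ring_1 poly"
  assumes "degree p \<le> k"
  shows "coeff ([:a, 1:] * p) (Suc k) = coeff p k"
  using assms by (simp add: coeff_eq_0)

lemma degree_linear_mult_le:
  fixes p :: "'a :: comm_ring_1 poly"
  assumes "degree p \<le> k"
  shows "degree ([:a, 1:] * p) \<le> Suc k"
  using assms by (intro order_trans[OF degree_mult_le]) simp

text \<open>Both parities go through one induction, as each step of the recurrence uses the two
  preceding denominators. For odd index the degree is only bounded, since the sum may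
  vanish.\<close>

lemma thiele_den_top_coeff:
  "degree (thiele_den \<phi> x (2 * k)) \<le> k \<and> coeff (thiele_den \<phi> x (2 * k)) k = 1 \<and>
   degree (thiele_den \<phi> x (Suc (2 * k))) \<le> k \<and>
   coeff (thiele_den \<phi> x (Suc (2 * k))) k = (\<Sum>j\<le>k. \<phi> (Suc (2 * j)))"
proof (induction k)
  case 0
  then show ?case by simp
next
  case (Suc k)
  let ?B = "thiele_den \<phi> x"
  have even_rec: "?B (2 * Suc k) =
      smult (\<phi> (2 * Suc k)) (?B (Suc (2 * k))) + [:- x (Suc (2 * k)), 1:] * ?B (2 * k)"
    by simp
  have odd_rec: "?B (Suc (2 * Suc k)) =
      smult (\<phi> (Suc (2 * Suc k))) (?B (2 * Suc k)) + [:- x (2 * Suc k), 1:] * ?B (Suc (2 * k))"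
    by simp
  have deg_even: "degree (?B (2 * Suc k)) \<le> Suc k"
    unfolding even_rec using Suc.IH
    by (intro degree_add_le degree_linear_mult_le order_trans[OF degree_smult_le]) simp_all
  \<comment> \<open>The \<open>smult\<close> term has degree at most \<open>k\<close>, so the linear
    factor alone passes the coefficient 1 on.\<close>
  have coeff_even: "coeff (?B (2 * Suc k)) (Suc k) = 1"
    unfolding even_rec coeff_add coeff_smult using Suc.IH
    by (simp add: coeff_linear_mult_Suc coeff_eq_0 del: mult_pCons_left)
  have "degree (?B (Suc (2 * Suc k))) \<le> Suc k"
    unfolding odd_rec using Suc.IH deg_even
    by (intro degree_add_le degree_linear_mult_le order_trans[OF degree_smult_le]) simp_all
  \<comment> \<open>Here both terms count: the \<open>smult\<close> term adds the new summand, since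
    \<open>coeff_even\<close> is 1, and the linear factor passes on the old sum.\<close>
  moreover have "coeff (?B (Suc (2 * Suc k))) (Suc k) = (\<Sum>j\<le>Suc k. \<phi> (Suc (2 * j)))"
    unfolding odd_rec coeff_add coeff_smult coeff_even using Suc.IH
    by (simp add: coeff_linear_mult_Suc del: mult_pCons_left)
  ultimately show ?case
    using deg_even coeff_even by blast
qed

text \<open>A nonzero coefficient at the degree bound settles both claims; for odd \<open>n\<close>
  it is the sum assumed nonzero.\<close>

lemma degree_thiele_den:
  assumes "odd n \<Longrightarrow> (\<Sum>i\<in>{i. i \<le> n \<and> odd i}. \<phi> i) \<noteq> 0"
  shows "thiele_den \<phi> x n \<noteq> 0" and "degree (thiele_den \<phi> x n) = n div 2"
proof -
  have "degree (thiele_den \<phi> x n) \<le> n div 2 \<and> coeff (thiele_den \<phi> x n) (n div 2) \<noteq> 0"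
  proof (cases "even n")
    case True
    then obtain k where "n = 2 * k" by blast
    then show ?thesis
      using thiele_den_top_coeff[of \<phi> x k] by simp
  next
    case False
    then obtain k where n: "n = Suc (2 * k)" by (auto elim: oddE)
    have "{i. i \<le> n \<and> odd i} = (\<lambda>j. Suc (2 * j)) ` {..k}"
      by (auto simp: n elim!: oddE)
    then have "(\<Sum>i\<in>{i. i \<le> n \<and> odd i}. \<phi> i) = (\<Sum>j\<le>k. \<phi> (Suc (2 * j)))"
      by (simp add: sum.reindex inj_on_def)
    then show ?thesis
      using thiele_den_top_coeff[of \<phi> x k] assms[OF False] by (simp add: n)
  qed
  then show "thiele_den \<phi> x n \<noteq> 0" "degree (thiele_den \<phi> x n) = n div 2"
    by (auto intro: antisym le_degree)
qed

theorem theoremB1: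
  fixes n :: nat and x f \<phi> :: "nat \<Rightarrow> complex"
  assumes "n \<ge> 1"
    and "inj_on x {0..n}"
    and "\<And>i. i \<le> n \<Longrightarrow> inverse_difference x f i i = Finite (\<phi> i)"
    and "odd n \<Longrightarrow> (\<Sum>i\<in>{i. i \<le> n \<and> odd i}. \<phi> i) \<noteq> 0"
  shows "regular_pencil (thiele_D \<phi> x n) (thiele_C n)
    \<and> finite_eigenvalues (thiele_D \<phi> x n) (thiele_C n) = thiele_poles \<phi> x n
    \<and> size (thiele_poles \<phi> x n) = n div 2"
  \<comment> \<open>Both root multisets belong to the same polynomial; by the fundamental theorem of
    algebra their size is its degree.\<close>
  using degree_thiele_den[of n \<phi> x] assms(4)
  by (simp add: regular_pencil_def finite_eigenvalues_def thiele_poles_def pencil_det_thiele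
      size_proots_complex)

end
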